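(* Let $\beta>0$, $L>0$, $l:=\lfloor\beta\rfloor$, and let $\mathbb T$ be an interval of $\mathbb R$. Let $K:\mathbb R\to\mathbb R$ be a (measurable) function such that $y\mapsto y^iK(y)$ is integrable for every $i\in\{0,1,\dots,l\}$, $\int_{\mathbb R}K(y)\,dy=1$, $\int_{\mathbb R}K(y)^2\,dy<\infty$, $C_\beta(K):=\int_{\mathbb R}|z|^\beta|K(z)|\,dz<\infty$, and $\int_{\mathbb R}y^iK(y)\,dy=0$ for every $i\in\{1,\dots,l\}$. Let $X_1,\dots,X_n$ ($n\in\mathbb N^*$) be independent random variables with common probability density $f$ with respect to Lebesgue measure, where $f$ belongs to the Hölder class $\Sigma(\beta,L)$ on $\mathbb T$, and let $\mathbf h_n=(h_1,\dots,h_n)$ with $0<h_n<\dots<h_1$. Then there exists a constant $c>0$ such that for all $x\in\mathbb T$, $$\mathbb E\big(|\widehat f_{n,\mathbf h_n}(x)-f(x)|^2\big)\leqslant\frac{c}{n^2}\left(\left|\sum_{k=1}^n\frac{h_k^\beta}{l!}\right|^2+\sum_{k=1}^n\frac1{h_k}\right),$$ where $c$ depends on $\beta$, $L$, $\|K\|_2$ and $C_\beta(K)$ (but not on $n$ and $h_1,\dots,h_n$).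
   Context: $\mathbb N^*$ is the set of positive integers; $\lfloor\beta\rfloor$ is the greatest integer less than or equal to $\beta$; $\|K\|_2^2=\int_{\mathbb R}K^2$. Hölder class: for an interval $\mathbb T$ of $\mathbb R$, $\Sigma(\beta,L)$ on $\mathbb T$ is the set of functions $\varphi:\mathbb T\to\mathbb R$ such that, with $l=\lfloor\beta\rfloor$, the derivative $\varphi^{(l)}$ exists and $|\varphi^{(l)}(y)-\varphi^{(l)}(x)|\leqslant L|y-x|^{\beta-l}$ for all $x\neq y$ in $\mathbb T$. Wolverton-Wagner estimator: for $x\in\mathbb R$, $$\widehat f_{n,\mathbf h_n}(x):=\frac1n\sum_{k=1}^n\frac1{h_k}K\left(\frac{X_k-x}{h_k}\right).$$
   Formalization: For T other than the whole line the claim fails near endpoints; the formal bound is for those x in T such that, for every k, K((y-x)/h_k) vanishes for almost every y outside T, and c may also depend on T; for T = R nothing is changed. *)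

theory Defs
  imports "HOL-Probability.Probability"
begin

(* The members are functions on T: only the values of \<phi> on T matter, and the derivatives are
   taken within T, hence one-sided at an endpoint belonging to T.  D i is the i-th derivative
   of \<phi>. *)
definition holder_class :: "real \<Rightarrow> real \<Rightarrow> real set \<Rightarrow> (real \<Rightarrow> real) set" where
  "holder_class \<beta> L T = {\<phi>. \<exists>D :: nat \<Rightarrow> real \<Rightarrow> real.
     (\<forall>x\<in>T. D 0 x = \<phi> x) \<and>
     (\<forall>i < nat \<lfloor>\<beta>\<rfloor>. \<forall>x\<in>T. (D i has_real_derivative D (Suc i) x) (at x within T)) \<and>
     (\<forall>x\<in>T. \<forall>y\<in>T. x \<noteq> y \<longrightarrow>
        \<bar>D (nat \<lfloor>\<beta>\<rfloor>) y - D (nat \<lfloor>\<beta>\<rfloor>) x\<bar> \<le> L * \<bar>y - x\<bar> powr (\<beta> - real (nat \<lfloor>\<beta>\<rfloor>)))}"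

definition kernel_of_order :: "nat \<Rightarrow> (real \<Rightarrow> real) \<Rightarrow> bool" where
  "kernel_of_order l K \<longleftrightarrow>
     K \<in> borel_measurable borel \<and>
     (\<forall>i \<le> l. integrable lborel (\<lambda>y. y ^ i * K y)) \<and>
     (LINT y|lborel. K y) = 1 \<and>
     (\<forall>i \<in> {1..l}. (LINT y|lborel. y ^ i * K y) = 0)"

definition L2_norm_fun :: "(real \<Rightarrow> real) \<Rightarrow> real" where
  "L2_norm_fun K = sqrt (LINT y|lborel. (K y)\<^sup>2)"

definition abs_moment :: "real \<Rightarrow> (real \<Rightarrow> real) \<Rightarrow> real" where
  "abs_moment \<beta> K = (LINT z|lborel. \<bar>z\<bar> powr \<beta> * \<bar>K z\<bar>)"

(* Here X is a realization of the sample; the indices run from 1 to n. *)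
definition wolverton_wagner ::
    "(real \<Rightarrow> real) \<Rightarrow> nat \<Rightarrow> (nat \<Rightarrow> real) \<Rightarrow> (nat \<Rightarrow> real) \<Rightarrow> real \<Rightarrow> real" where
  "wolverton_wagner K n h X x = (1 / real n) * (\<Sum>k=1..n. (1 / h k) * K ((X k - x) / h k))"

(* The estimator at x with bandwidth b only uses observations in T, up to a null set.  This is
   automatic when T is the whole line.  When T is a proper interval it cannot be omitted from
   the risk bound, since nothing is known about the density outside T: for the uniform density
   on T = {0..1}, \<beta> = 1/2, K the indicator of {-1/2..1/2} and x = 0, the estimator has mean 1/2
   for all bandwidths below 2, whereas the density at 0 is 1. *)
definition window_in :: "real set \<Rightarrow> (real \<Rightarrow> real) \<Rightarrow> real \<Rightarrow> real \<Rightarrow> bool" where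
  "window_in T K b x \<longleftrightarrow> (AE y in lborel. K ((y - x) / b) \<noteq> 0 \<longrightarrow> y \<in> T)"

end

theory Submission
  imports Defs
begin

text \<open>
  The mean square error is the squared bias plus the variance.

  Bias. On \<open>T\<close> a function \<open>f\<close> of the Hoelder class differs from its Taylor polynomial of degree
  \<open>\<lfloor>\<beta>\<rfloor>\<close> at \<open>x\<close> by at most \<open>L * \<bar>y - x\<bar> powr \<beta>\<close> (\<open>holder_class_taylor\<close>). A kernel of order \<open>\<lfloor>\<beta>\<rfloor>\<close>,
  rescaled and centred at \<open>x\<close>, integrates the polynomial exactly to \<open>f x\<close>, so the term with
  bandwidth \<open>h\<close> has bias at most \<open>L * C * h powr \<beta>\<close>, where \<open>C\<close> is the absolute moment of order \<open>\<beta>\<close>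
  of the kernel (\<open>rescaled_kernel_bias\<close>).

  Variance. By independence the variances of the terms add up. If \<open>f \<le> B\<close> on \<open>T\<close>, the second moment
  of the term with bandwidth \<open>h\<close> is at most \<open>B * \<kappa>\<^sup>2 / h\<close>, where \<open>\<kappa>\<close> is the L2 norm of the kernel
  (\<open>rescaled_kernel_second_moment\<close>).

  The essential point is that one bound \<open>B\<close> serves all probability densities of the Hoelder class on
  \<open>T\<close> (\<open>density_bound_on_interval\<close>). A finite difference of order \<open>\<lfloor>\<beta>\<rfloor> + 1\<close> annihilates the Taylor
  polynomial at \<open>y\<close>, hence bounds \<open>f y\<close>, up to Taylor remainders, by the values of \<open>f\<close> at equidistant
  points of \<open>T\<close> on one side of \<open>y\<close>. Averaging over the step width turns these values into
  integrals of \<open>f\<close>, at most the total mass 1, divided by the range of the widths. That range depends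
  on the length of \<open>T\<close>, and so do \<open>B\<close> and the final constant.
\<close>

section \<open>Taylor expansion in Hoelder classes\<close>

text \<open>
  The remainder of order \<open>l + 1\<close> of \<open>D 0\<close> vanishes at \<open>x\<close>, and its derivative is the remainder of order
  \<open>l\<close> of \<open>D 1\<close>. By induction this derivative is at most \<open>L * \<bar>y - x\<bar> powr (l + \<gamma>)\<close> on the segment from
  \<open>x\<close> to \<open>y\<close>, and the mean value inequality supplies one more factor \<open>\<bar>y - x\<bar>\<close>. This argument
  needs derivatives within \<open>T\<close> only, one-sided at its endpoints.
\<close>

lemma taylor_remainder_holder_within:
  fixes D :: "nat \<Rightarrow> real \<Rightarrow> real"
  assumes "convex T" "L \<ge> 0" "\<gamma> \<ge> 0"
    and "\<And>i x. i < l \<Longrightarrow> x \<in> T \<Longrightarrow> (D i has_real_derivative D (Suc i) x) (at x within T)"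
    and "\<And>x y. x \<in> T \<Longrightarrow> y \<in> T \<Longrightarrow> x \<noteq> y \<Longrightarrow> \<bar>D l y - D l x\<bar> \<le> L * \<bar>y - x\<bar> powr \<gamma>"
    and "x \<in> T" "y \<in> T"
  shows "\<bar>D 0 y - (\<Sum>i\<le>l. D i x / fact i * (y - x) ^ i)\<bar> \<le> L * \<bar>y - x\<bar> powr (real l + \<gamma>)"
  using assms(4-)
proof (induction l arbitrary: D y)
  case 0
  then show ?case using \<open>L \<ge> 0\<close> by (cases "x = y") auto
next
  case (Suc l)
  define R where "R z = D 0 z - (\<Sum>i\<le>Suc l. D i x / fact i * (z - x) ^ i)" for z
  define R' where "R' z = D 1 z - (\<Sum>i\<le>l. D (Suc i) x / fact i * (z - x) ^ i)" for z
  let ?S = "closed_segment x y"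
  let ?B = "L * \<bar>y - x\<bar> powr (real l + \<gamma>)"
  have S: "?S \<subseteq> T"
    using \<open>convex T\<close> Suc.prems by (simp add: closed_segment_subset)
  have R'_bound: "\<bar>R' z\<bar> \<le> L * \<bar>z - x\<bar> powr (real l + \<gamma>)" if "z \<in> T" for z
    unfolding R'_def using Suc.IH[of "\<lambda>i. D (Suc i)" z] Suc.prems that by auto
  have deriv: "(R has_real_derivative R' z) (at z within ?S)" if z: "z \<in> ?S" for z
  proof -
    have eq: "R = (\<lambda>z. D 0 z - (D 0 x + (\<Sum>i\<le>l. D (Suc i) x / fact (Suc i) * (z - x) ^ Suc i)))"
      unfolding R_def by (subst sum.atMost_Suc_shift) simp
    have "(D 0 has_real_derivative D 1 z) (at z within ?S)"
      using Suc.prems(1)[of 0 z] S z by (auto intro: DERIV_subset)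
    moreover have "((\<lambda>z. D (Suc i) x / fact (Suc i) * (z - x) ^ Suc i) has_real_derivative
        D (Suc i) x / fact i * (z - x) ^ i) (at z within ?S)" for i
      by (rule derivative_eq_intros refl | simp)+
    ultimately have "(R has_real_derivative D 1 z - (0 + (\<Sum>i\<le>l. D (Suc i) x / fact i * (z - x) ^ i)))
        (at z within ?S)"
      unfolding eq by (intro DERIV_diff DERIV_add DERIV_const DERIV_sum)
    then show ?thesis
      by (simp add: R'_def)
  qed
  have "norm (R y - R x) \<le> ?B * norm (y - x)"
  proof (rule field_differentiable_bound[OF convex_closed_segment deriv])
    fix z assume z: "z \<in> ?S"
    have "\<bar>z - x\<bar> \<le> \<bar>y - x\<bar>"
      using segment_bound1[OF z] by simp
    then have "L * \<bar>z - x\<bar> powr (real l + \<gamma>) \<le> ?B"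
      using \<open>L \<ge> 0\<close> \<open>\<gamma> \<ge> 0\<close> by (intro mult_left_mono powr_mono2) auto
    then show "norm (R' z) \<le> ?B"
      using R'_bound[of z] S z by auto
  qed auto
  moreover have "R x = 0"
    unfolding R_def by (subst sum.atMost_Suc_shift) simp
  moreover have "\<bar>y - x\<bar> powr (real l + \<gamma>) * \<bar>y - x\<bar> = \<bar>y - x\<bar> powr (real (Suc l) + \<gamma>)"
    by (cases "x = y") (auto simp: powr_add powr_realpow)
  ultimately show ?case
    unfolding R_def by (simp add: mult.assoc)
qed

lemma holder_class_taylor:
  assumes "f \<in> holder_class \<beta> L T" "\<beta> > 0" "L \<ge> 0" "is_interval T" "x \<in> T"
  obtains a :: "nat \<Rightarrow> real" where "a 0 = f x"
    and "\<And>y. y \<in> T \<Longrightarrow> \<bar>f y - (\<Sum>i\<le>nat \<lfloor>\<beta>\<rfloor>. a i * (y - x) ^ i)\<bar> \<le> L * \<bar>y - x\<bar> powr \<beta>"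
proof -
  let ?l = "nat \<lfloor>\<beta>\<rfloor>"
  have l: "real ?l \<le> \<beta>"
    using \<open>\<beta> > 0\<close> by (simp add: of_nat_nat)
  obtain D where D0: "\<forall>x\<in>T. D 0 x = f x"
    and D: "\<forall>i < ?l. \<forall>x\<in>T. (D i has_real_derivative D (Suc i) x) (at x within T)"
    and Dl: "\<forall>x\<in>T. \<forall>y\<in>T. x \<noteq> y \<longrightarrow> \<bar>D ?l y - D ?l x\<bar> \<le> L * \<bar>y - x\<bar> powr (\<beta> - real ?l)"
    using assms(1) unfolding holder_class_def by blast
  show ?thesis
  proof (rule that[of "\<lambda>i. D i x / fact i"])
    show "D 0 x / fact 0 = f x" using D0 \<open>x \<in> T\<close> by simp
    fix y assume y: "y \<in> T"
    have "\<bar>D 0 y - (\<Sum>i\<le>?l. D i x / fact i * (y - x) ^ i)\<bar> \<le> L * \<bar>y - x\<bar> powr (real ?l + (\<beta> - real ?l))"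
      by (rule taylor_remainder_holder_within[where T = T])
        (use D Dl l y assms in \<open>auto simp: is_interval_convex_1\<close>)
    then show "\<bar>f y - (\<Sum>i\<le>?l. D i x / fact i * (y - x) ^ i)\<bar> \<le> L * \<bar>y - x\<bar> powr \<beta>"
      using D0 y by simp
  qed
qed

section \<open>A uniform bound for densities in a Hoelder class\<close>

text \<open>
  The sum is, up to sign, the finite difference of order \<open>m\<close> at 0 of the monomial of degree \<open>i\<close>, and
  each difference lowers the degree. In the induction step Pascal's rule turns the difference of
  order \<open>m + 1\<close> of \<open>j ^ i\<close> into that of order \<open>m\<close> of \<open>(j + 1) ^ i - j ^ i\<close>, a combination of powers
  below \<open>i\<close>.
\<close>

lemma alternating_binomial_power_sum_eq_0:
  assumes "i < m"
  shows "(\<Sum>j\<le>m. (- 1) ^ j * real (m choose j) * real j ^ i) = 0"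
  using assms
proof (induction m arbitrary: i)
  case 0
  then show ?case by simp
next
  case (Suc m)
  have shift: "real (Suc j) ^ i = (\<Sum>r<i. real (i choose r) * real j ^ r) + real j ^ i" for j
  proof -
    have "real (Suc j) ^ i = (\<Sum>r\<le>i. real (i choose r) * real j ^ r)"
      using binomial_ring[of "real j" 1 i] by (simp add: add.commute)
    also have "\<dots> = (\<Sum>r<Suc i. real (i choose r) * real j ^ r)"
      by (simp add: lessThan_Suc_atMost)
    finally show ?thesis by simp
  qed
  let ?a = "\<lambda>j. (- 1) ^ j * real (m choose j) :: real"
  have "(\<Sum>j\<le>Suc m. (- 1) ^ j * real (Suc m choose j) * real j ^ i)
      = 0 ^ i + (\<Sum>j\<le>m. (- 1) ^ Suc j * real (m choose Suc j) * real (Suc j) ^ i)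
        - (\<Sum>j\<le>m. ?a j * real (Suc j) ^ i)"
    by (subst sum.atMost_Suc_shift) (simp add: sum_subtractf algebra_simps sum.distrib sum_negf del: sum.atMost_Suc)
  also have "0 ^ i + (\<Sum>j\<le>m. (- 1) ^ Suc j * real (m choose Suc j) * real (Suc j) ^ i)
      = (\<Sum>j\<le>Suc m. ?a j * real j ^ i)"
    by (subst sum.atMost_Suc_shift) (simp del: sum.atMost_Suc)
  also have "\<dots> = (\<Sum>j\<le>m. ?a j * real j ^ i)"
    by simp
  also have "\<dots> - (\<Sum>j\<le>m. ?a j * real (Suc j) ^ i)
      = - (\<Sum>j\<le>m. ?a j * (\<Sum>r<i. real (i choose r) * real j ^ r))"
    by (simp add: shift algebra_simps sum.distrib del: of_nat_Suc)
  also have "(\<Sum>j\<le>m. ?a j * (\<Sum>r<i. real (i choose r) * real j ^ r))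
      = (\<Sum>r<i. real (i choose r) * (\<Sum>j\<le>m. ?a j * real j ^ r))"
    unfolding sum_distrib_left by (subst sum.swap) (simp add: mult_ac)
  also have "\<dots> = 0"
    using Suc by simp
  finally show ?case by simp
qed

text \<open>
  In the difference \<open>\<Sum>j\<le>m. (- 1) ^ j * (m choose j) * f (y + j * u)\<close> the Taylor polynomial of \<open>f\<close> at
  \<open>y\<close>, of degree less than \<open>m\<close>, contributes nothing. So its value \<open>f y\<close> at \<open>y\<close> is controlled by its
  values at the other nodes, and these differ from the values of \<open>f\<close> only by remainders. The unknown derivatives
  of \<open>f\<close> at \<open>y\<close> thus disappear from the bound.
\<close>

lemma finite_difference_bound:
  fixes f :: "real \<Rightarrow> real"
  assumes f: "f \<in> holder_class \<beta> L T" "\<beta> > 0" "L \<ge> 0" "is_interval T" "\<And>y. f y \<ge> 0"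
    and m: "m = Suc (nat \<lfloor>\<beta>\<rfloor>)"
    and y: "y \<in> T" and T: "\<And>j. j \<le> m \<Longrightarrow> y + real j * u \<in> T"
    and u: "real m * \<bar>u\<bar> \<le> \<delta>"
  shows "f y \<le> 2 ^ m * (L * \<delta> powr \<beta>) + (\<Sum>j\<in>{1..m}. real (m choose j) * f (y + real j * u))"
proof -
  obtain a where a0: "a 0 = f y"
    and a: "\<And>z. z \<in> T \<Longrightarrow> \<bar>f z - (\<Sum>i\<le>nat \<lfloor>\<beta>\<rfloor>. a i * (z - y) ^ i)\<bar> \<le> L * \<bar>z - y\<bar> powr \<beta>"
    using holder_class_taylor[OF f(1-4) y] by blast
  let ?P = "\<lambda>j. \<Sum>i<m. a i * (real j * u) ^ i"
  have R: "\<bar>f (y + real j * u) - ?P j\<bar> \<le> L * \<delta> powr \<beta>" if "j \<le> m" for j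
  proof -
    have "\<bar>f (y + real j * u) - ?P j\<bar> \<le> L * \<bar>real j * u\<bar> powr \<beta>"
      using a[OF T[OF that]] by (simp add: m lessThan_Suc_atMost)
    moreover have "\<bar>real j * u\<bar> \<le> \<delta>"
      using u that mult_right_mono[of "real j" "real m" "\<bar>u\<bar>"] by (simp add: abs_mult)
    then have "L * \<bar>real j * u\<bar> powr \<beta> \<le> L * \<delta> powr \<beta>"
      using f by (intro mult_left_mono powr_mono2) auto
    ultimately show ?thesis by simp
  qed
  have "(\<Sum>j\<le>m. (- 1) ^ j * real (m choose j) * ?P j)
      = (\<Sum>i<m. a i * u ^ i * (\<Sum>j\<le>m. (- 1) ^ j * real (m choose j) * real j ^ i))"
    unfolding sum_distrib_left by (subst sum.swap) (simp add: power_mult_distrib mult_ac)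
  also have "\<dots> = 0"
    by (intro sum.neutral) (simp add: alternating_binomial_power_sum_eq_0)
  finally have "(\<Sum>j\<le>m. (- 1) ^ j * real (m choose j) * ?P j) = 0" .
  moreover have split: "{..m} = insert 0 {1..m}" by auto
  moreover have "?P 0 = f y"
    using a0 m by (simp add: lessThan_Suc_atMost atMost_atLeast0 sum.atLeast_Suc_atMost[of 0])
  ultimately have "f y = - (\<Sum>j\<in>{1..m}. (- 1) ^ j * real (m choose j) * ?P j)"
    by simp
  also have "\<dots> \<le> (\<Sum>j\<in>{1..m}. real (m choose j) * \<bar>?P j\<bar>)"
    unfolding sum_negf[symmetric]
    by (intro sum_mono) (auto simp: abs_mult intro!: order_trans[OF abs_ge_minus_self])
  also have "\<dots> \<le> (\<Sum>j\<in>{1..m}. real (m choose j) * (L * \<delta> powr \<beta> + f (y + real j * u)))"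
  proof (intro sum_mono mult_left_mono)
    fix j assume "j \<in> {1..m}"
    then show "\<bar>?P j\<bar> \<le> L * \<delta> powr \<beta> + f (y + real j * u)"
      using R[of j] f(5)[of "y + real j * u"] by auto
  qed simp
  also have "\<dots> = (\<Sum>j\<in>{1..m}. real (m choose j)) * (L * \<delta> powr \<beta>)
      + (\<Sum>j\<in>{1..m}. real (m choose j) * f (y + real j * u))"
    by (simp add: algebra_simps sum.distrib sum_distrib_left)
  also have "(\<Sum>j\<in>{1..m}. real (m choose j)) \<le> (\<Sum>j\<le>m. real (m choose j))"
    by (intro sum_mono2) auto
  also have "\<dots> = 2 ^ m"
    using choose_row_sum[of m] by (metis of_nat_sum of_nat_power of_nat_numeral)
  finally show ?thesis
    using f(3) by (simp add: mult_right_mono)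
qed

text \<open>
  A point left of the midpoint of \<open>a\<close> and \<open>b\<close> has room towards \<open>b\<close>, any other point towards \<open>a\<close>; \<open>s\<close> is
  the direction.
\<close>

lemma interval_one_sided_room:
  fixes T :: "real set"
  assumes "is_interval T" "a \<in> T" "b \<in> T" "a < b" "y \<in> T"
  obtains s :: real where "\<bar>s\<bar> = 1" "\<And>t. 0 \<le> t \<Longrightarrow> t \<le> (b - a) / 2 \<Longrightarrow> y + s * t \<in> T"
proof (cases "y \<le> (a + b) / 2")
  case True
  show ?thesis
  proof (rule that[of 1])
    fix t :: real assume "0 \<le> t" "t \<le> (b - a) / 2"
    then have "y \<le> y + 1 * t" "y + 1 * t \<le> b" using True by (simp_all add: field_simps)
    then show "y + 1 * t \<in> T" using mem_is_interval_1_I assms by blast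
  qed simp
next
  case False
  show ?thesis
  proof (rule that[of "- 1"])
    fix t :: real assume "0 \<le> t" "t \<le> (b - a) / 2"
    then have "a \<le> y + - 1 * t" "y + - 1 * t \<le> y" using False by (simp_all add: field_simps)
    then show "y + - 1 * t \<in> T" using mem_is_interval_1_I assms by blast
  qed simp
qed

text \<open>
  Averaging \<open>finite_difference_bound\<close> over all steps up to a fixed width, which depends on \<open>T\<close> and \<open>\<beta>\<close>
  only, replaces the values of \<open>f\<close> at the other nodes by integrals of \<open>f\<close>. These are at most the total
  mass 1, whatever \<open>f\<close> is. The bound holds almost everywhere on \<open>T\<close>, which is what
  integration against \<open>f\<close> needs and which also covers an interval with at most one point, where a density may take any value.
\<close>

lemma density_bound_on_interval:
  assumes "is_interval T" "\<beta> > 0" "L \<ge> 0"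
  obtains B where "B \<ge> 0"
    and "\<And>f. f \<in> holder_class \<beta> L T \<Longrightarrow> (\<And>y. f y \<ge> 0) \<Longrightarrow> integrable lborel f
      \<Longrightarrow> (LINT y|lborel. f y) = 1 \<Longrightarrow> AE y in lborel. y \<in> T \<longrightarrow> f y \<le> B"
proof (cases "\<exists>a\<in>T. \<exists>b\<in>T. a < b")
  case False
  then have "T = {} \<or> (\<exists>a. T = {a})"
    by (metis insertI1 is_singletonI' is_singleton_def linorder_neqE)
  then have "AE y in lborel. y \<in> T \<longrightarrow> f y \<le> 0" for f :: "real \<Rightarrow> real"
  proof (elim disjE exE)
    fix a assume "T = {a}"
    then show ?thesis by (intro eventually_mono[OF AE_lborel_singleton[of a]]) simp
  qed simp
  then show ?thesis by (intro that[of 0]) auto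
next
  case True
  then obtain a b where ab: "a \<in> T" "b \<in> T" "a < b" by blast
  define m where "m = Suc (nat \<lfloor>\<beta>\<rfloor>)"
  define \<delta> where "\<delta> = (b - a) / 2"
  \<comment> \<open>With steps of size at most \<open>d\<close> even the farthest of the \<open>m\<close> nodes stays within distance \<open>\<delta>\<close>.\<close>
  define d where "d = \<delta> / real m"
  have pos: "\<delta> > 0" "d > 0" "m > 0" using ab by (auto simp: \<delta>_def d_def m_def)
  define A where "A = 2 ^ m * (L * \<delta> powr \<beta>)"
  have A: "A \<ge> 0" using assms by (simp add: A_def)
  show ?thesis
  proof (rule that[of "A + 2 ^ m / d"])
    show "A + 2 ^ m / d \<ge> 0" using A pos by simp
    fix f :: "real \<Rightarrow> real" assume f: "f \<in> holder_class \<beta> L T" "\<And>y. f y \<ge> 0" "integrable lborel f"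
      "(LINT y|lborel. f y) = 1"
    have "f y \<le> A + 2 ^ m / d" if y: "y \<in> T" for y
    proof -
      obtain s where s: "\<bar>s\<bar> = 1" and sT: "\<And>t. 0 \<le> t \<Longrightarrow> t \<le> \<delta> \<Longrightarrow> y + s * t \<in> T"
        using interval_one_sided_room[OF assms(1) ab y] unfolding \<delta>_def by blast
      have le: "real j * u \<le> \<delta>" if "j \<le> m" "0 \<le> u" "u \<le> d" for j u
      proof -
        have "real j * u \<le> real m * d"
          using that by (intro mult_mono) auto
        then show ?thesis using pos by (simp add: d_def)
      qed
      \<comment> \<open>The factor \<open>s\<close> turns the steps towards the side of \<open>y\<close> on which \<open>T\<close> has room.\<close>
      let ?g = "\<lambda>u. \<Sum>j\<in>{1..m}. real (m choose j) * f (y + (s * real j) * u)"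
      have s0: "s * real j \<noteq> 0" if "j \<in> {1..m}" for j
        using that s by auto
      have g_int: "integrable lborel ?g"
        using s0 f(3) by (intro Bochner_Integration.integrable_sum integrable_mult_right lborel_integrable_real_affine) auto
      have f_int: "(LINT u|lborel. f (y + (s * real j) * u)) \<le> 1" if j: "j \<in> {1..m}" for j
      proof -
        have "1 = real j * (LINT u|lborel. f (y + (s * real j) * u))"
          using lborel_integral_real_affine[OF s0[OF j], of f y] f(4) s by (simp add: abs_mult)
        moreover have "(LINT u|lborel. f (y + (s * real j) * u)) \<ge> 0"
          using f(2) by simp
        ultimately show ?thesis
          using j mult_right_mono[of 1 "real j" "LINT u|lborel. f (y + (s * real j) * u)"] by auto
      qed
      have "(LINT u|lborel. ?g u) = (\<Sum>j\<in>{1..m}. real (m choose j) * (LINT u|lborel. f (y + (s * real j) * u)))"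
        using s0 f(3)
        by (subst Bochner_Integration.integral_sum)
          (auto intro!: integrable_mult_right lborel_integrable_real_affine)
      also have "\<dots> \<le> (\<Sum>j\<in>{1..m}. real (m choose j) * 1)"
        by (intro sum_mono mult_left_mono f_int) auto
      also have "\<dots> \<le> (\<Sum>j\<le>m. real (m choose j))"
        by (simp, intro sum_mono2) auto
      also have "\<dots> = 2 ^ m"
        using choose_row_sum[of m] by (metis of_nat_sum of_nat_power of_nat_numeral)
      finally have g_le: "(LINT u|lborel. ?g u) \<le> 2 ^ m" .
      have ind: "integrable lborel (\<lambda>u. indicator {0..d} u * (c::real))"
        "(LINT u|lborel. indicator {0..d} u * (c::real)) = d * c" for c
        using pos by (simp_all add: integrable_mult_left)
      have "d * f y = (LINT u|lborel. indicator {0..d} u * f y)"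
        by (simp only: ind(2))
      also have "\<dots> \<le> (LINT u|lborel. indicator {0..d} u * A + ?g u)"
      proof (rule integral_mono[OF ind(1)])
        show "integrable lborel (\<lambda>u. indicator {0..d} u * A + ?g u)"
          using ind(1) g_int by (rule Bochner_Integration.integrable_add)
        fix u :: real
        have g0: "?g u \<ge> 0" using f(2) by (intro sum_nonneg) auto
        show "indicator {0..d} u * f y \<le> indicator {0..d} u * A + ?g u"
        proof (cases "u \<in> {0..d}")
          case True
          have "f y \<le> A + (\<Sum>j\<in>{1..m}. real (m choose j) * f (y + real j * (s * u)))"
            unfolding A_def
          proof (rule finite_difference_bound[OF f(1) assms(2,3,1) f(2) m_def y])
            show "y + real j * (s * u) \<in> T" if "j \<le> m" for j
              using sT[of "real j * u"] le[of j u] that True by (simp add: mult_ac)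
            show "real m * \<bar>s * u\<bar> \<le> \<delta>"
              using le[of m u] True s by (simp add: abs_mult)
          qed
          then show ?thesis using True by (simp add: mult_ac)
        qed (use g0 in simp)
      qed
      also have "\<dots> = d * A + (LINT u|lborel. ?g u)"
        using ind g_int by (subst Bochner_Integration.integral_add) auto
      finally have "d * f y \<le> d * A + 2 ^ m" using g_le by simp
      then show ?thesis using pos by (simp add: field_simps)
    qed
    then show "AE y in lborel. y \<in> T \<longrightarrow> f y \<le> A + 2 ^ m / d" by simp
  qed
qed

section \<open>Bias and second moment of a rescaled kernel\<close>

text \<open>
  The moment conditions make integration against \<open>g\<close> send the Taylor polynomial of \<open>f\<close> at \<open>x\<close> to its
  constant term \<open>f x\<close>, so that only the remainder is left. The Taylor bound holds on \<open>T\<close> only,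
  hence the condition that \<open>g\<close> vanishes almost everywhere outside \<open>T\<close>.
\<close>

lemma holder_class_kernel_reproduction:
  assumes dens: "f \<in> holder_class \<beta> L T" "\<beta> > 0" "L \<ge> 0" "is_interval T" "x \<in> T"
    and [measurable]: "f \<in> borel_measurable borel" "g \<in> borel_measurable borel"
    and int: "\<And>i. i \<le> nat \<lfloor>\<beta>\<rfloor> \<Longrightarrow> integrable lborel (\<lambda>y. (y - x) ^ i * g y)"
    and one: "(LINT y|lborel. g y) = 1"
    and zero: "\<And>i. i \<in> {1..nat \<lfloor>\<beta>\<rfloor>} \<Longrightarrow> (LINT y|lborel. (y - x) ^ i * g y) = 0"
    and abs: "integrable lborel (\<lambda>y. \<bar>y - x\<bar> powr \<beta> * \<bar>g y\<bar>)"
    and supp: "AE y in lborel. g y \<noteq> 0 \<longrightarrow> y \<in> T"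
  shows "\<bar>(LINT y|lborel. f y * g y) - f x\<bar> \<le> L * (LINT y|lborel. \<bar>y - x\<bar> powr \<beta> * \<bar>g y\<bar>)"
proof -
  let ?l = "nat \<lfloor>\<beta>\<rfloor>"
  obtain a where a0: "a 0 = f x"
    and a: "\<And>y. y \<in> T \<Longrightarrow> \<bar>f y - (\<Sum>i\<le>?l. a i * (y - x) ^ i)\<bar> \<le> L * \<bar>y - x\<bar> powr \<beta>"
    using holder_class_taylor[OF dens] by blast
  let ?P = "\<lambda>y. \<Sum>i\<le>?l. a i * ((y - x) ^ i * g y)"
  define R where "R y = (f y - (\<Sum>i\<le>?l. a i * (y - x) ^ i)) * g y" for y
  have [measurable]: "R \<in> borel_measurable borel" unfolding R_def by measurable
  have split: "f y * g y = ?P y + R y" for y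
    by (simp add: R_def algebra_simps sum_distrib_left)
  have P: "integrable lborel ?P"
    using int by (intro Bochner_Integration.integrable_sum integrable_mult_right) auto
  have "(LINT y|lborel. ?P y) = (\<Sum>i\<le>?l. a i * (LINT y|lborel. (y - x) ^ i * g y))"
    using int by (subst Bochner_Integration.integral_sum) auto
  also have "\<dots> = (\<Sum>i\<in>insert 0 {1..?l}. a i * (LINT y|lborel. (y - x) ^ i * g y))"
    by (intro sum.cong) auto
  also have "\<dots> = f x"
    using one zero a0 by simp
  finally have P_eq: "(LINT y|lborel. ?P y) = f x" .
  have R_le: "AE y in lborel. norm (R y) \<le> L * (\<bar>y - x\<bar> powr \<beta> * \<bar>g y\<bar>)"
    using supp
  proof eventually_elim
    case (elim y)
    then show ?case
      using a[of y] mult_right_mono[of _ _ "\<bar>g y\<bar>"]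
      by (cases "g y = 0") (auto simp: R_def abs_mult mult.assoc[symmetric])
  qed
  have abs': "integrable lborel (\<lambda>y. L * (\<bar>y - x\<bar> powr \<beta> * \<bar>g y\<bar>))"
    using abs by simp
  have R: "integrable lborel R"
    by (rule Bochner_Integration.integrable_bound[OF abs'])
      (use R_le \<open>L \<ge> 0\<close> in \<open>auto simp: abs_mult\<close>)
  have "(LINT y|lborel. f y * g y) - f x = (LINT y|lborel. R y)"
    unfolding split using P R P_eq by simp
  also have "\<bar>\<dots>\<bar> \<le> (LINT y|lborel. L * (\<bar>y - x\<bar> powr \<beta> * \<bar>g y\<bar>))"
    using integral_abs_bound[of lborel R] integral_mono_AE[OF integrable_norm[OF R] abs' R_le]
    by (simp only: real_norm_def)
  finally show ?thesis by simp
qed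

lemma has_bochner_integral_rescaled:
  fixes \<phi> :: "real \<Rightarrow> real"
  assumes "h > 0" "integrable lborel \<phi>"
  shows "has_bochner_integral lborel (\<lambda>y. (1 / h) * \<phi> ((y - x) / h)) (LINT u|lborel. \<phi> u)"
proof -
  have eq: "(y - x) / h = - x / h + (1 / h) * y" for y
    by (simp add: field_simps diff_divide_distrib)
  have "1 / h \<noteq> 0" using assms by simp
  from lborel_integrable_real_affine[OF assms(2) this, of "- x / h"]
    lborel_integral_real_affine[OF this, of \<phi> "- x / h"]
  show ?thesis
    using assms(1) unfolding eq has_bochner_integral_iff by simp
qed

text \<open>
  The substitution \<open>u = (y - x) / h\<close> multiplies the moment of order \<open>i\<close> by \<open>h ^ i\<close>. The rescaled kernel
  therefore still has vanishing moments, and its absolute moment of order \<open>\<beta>\<close> yields the rate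
  \<open>h powr \<beta>\<close>.
\<close>

lemma rescaled_kernel_bias:
  assumes K: "kernel_of_order (nat \<lfloor>\<beta>\<rfloor>) K" "integrable lborel (\<lambda>z. \<bar>z\<bar> powr \<beta> * \<bar>K z\<bar>)"
    and f: "f \<in> holder_class \<beta> L T" "\<beta> > 0" "L \<ge> 0" "is_interval T" "x \<in> T" "f \<in> borel_measurable borel"
    and h: "h > 0" "window_in T K h x"
  shows "\<bar>(LINT y|lborel. f y * (1 / h * K ((y - x) / h))) - f x\<bar> \<le> L * (h powr \<beta> * abs_moment \<beta> K)"
proof -
  let ?g = "\<lambda>y. 1 / h * K ((y - x) / h)"
  have [measurable]: "K \<in> borel_measurable borel"
    using K(1) by (simp add: kernel_of_order_def)
  have scale: "(y - x) ^ i * ?g y = h ^ i * (1 / h * (((y - x) / h) ^ i * K ((y - x) / h)))" for i y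
    using h by (simp add: power_divide)
  have moment: "has_bochner_integral lborel (\<lambda>y. (y - x) ^ i * ?g y) (h ^ i * (LINT u|lborel. u ^ i * K u))"
    if "i \<le> nat \<lfloor>\<beta>\<rfloor>" for i
    unfolding scale using that K(1) h(1)
    by (intro has_bochner_integral_mult_right has_bochner_integral_rescaled[where \<phi> = "\<lambda>u. u ^ i * K u"])
      (auto simp: kernel_of_order_def)
  have "\<bar>y - x\<bar> powr \<beta> * \<bar>?g y\<bar> = h powr \<beta> * (1 / h * (\<bar>(y - x) / h\<bar> powr \<beta> * \<bar>K ((y - x) / h)\<bar>))" for y
    using h by (simp add: powr_divide abs_mult)
  then have abs: "has_bochner_integral lborel (\<lambda>y. \<bar>y - x\<bar> powr \<beta> * \<bar>?g y\<bar>) (h powr \<beta> * abs_moment \<beta> K)"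
    unfolding abs_moment_def using K(2) h(1)
    by (simp only:) (intro has_bochner_integral_mult_right
        has_bochner_integral_rescaled[where \<phi> = "\<lambda>u. \<bar>u\<bar> powr \<beta> * \<bar>K u\<bar>"])
  have "\<bar>(LINT y|lborel. f y * ?g y) - f x\<bar> \<le> L * (LINT y|lborel. \<bar>y - x\<bar> powr \<beta> * \<bar>?g y\<bar>)"
  proof (rule holder_class_kernel_reproduction[OF f])
    show "?g \<in> borel_measurable borel" by measurable
    show "integrable lborel (\<lambda>y. (y - x) ^ i * ?g y)" if "i \<le> nat \<lfloor>\<beta>\<rfloor>" for i
      using moment[OF that] by (simp only: has_bochner_integral_iff)
    show "(LINT y|lborel. ?g y) = 1"
      using moment[of 0] K(1) by (simp add: has_bochner_integral_iff kernel_of_order_def)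
    show "(LINT y|lborel. (y - x) ^ i * ?g y) = 0" if "i \<in> {1..nat \<lfloor>\<beta>\<rfloor>}" for i
      using moment[of i] K(1) that by (auto simp: has_bochner_integral_iff kernel_of_order_def)
    show "integrable lborel (\<lambda>y. \<bar>y - x\<bar> powr \<beta> * \<bar>?g y\<bar>)"
      using abs by (simp only: has_bochner_integral_iff)
    show "AE y in lborel. ?g y \<noteq> 0 \<longrightarrow> y \<in> T"
      using h(2) unfolding window_in_def by eventually_elim auto
  qed
  then show ?thesis
    using abs by (simp only: has_bochner_integral_iff)
qed

text \<open>
  The kernel window lies in \<open>T\<close>, where \<open>f\<close> is at most \<open>B\<close>; substituting \<open>u = (y - x) / h\<close> in the integral
  of the squared kernel turns \<open>1 / h\<^sup>2\<close> into \<open>1 / h\<close>.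
\<close>

lemma rescaled_kernel_second_moment:
  assumes [measurable]: "K \<in> borel_measurable borel" "f \<in> borel_measurable borel"
    and K: "integrable lborel (\<lambda>y. (K y)\<^sup>2)"
    and f: "\<And>y. f y \<ge> 0" "AE y in lborel. y \<in> T \<longrightarrow> f y \<le> B"
    and h: "h > 0" "window_in T K h x"
  shows "integrable lborel (\<lambda>y. f y * (1 / h * K ((y - x) / h))\<^sup>2)" (is ?int)
    and "(LINT y|lborel. f y * (1 / h * K ((y - x) / h))\<^sup>2) \<le> B * (L2_norm_fun K)\<^sup>2 / h" (is ?bd)
proof -
  let ?u = "\<lambda>y. B / h * (1 / h * (K ((y - x) / h))\<^sup>2)"
  have norm: "(L2_norm_fun K)\<^sup>2 = (LINT y|lborel. (K y)\<^sup>2)"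
    by (simp add: L2_norm_fun_def)
  have u: "has_bochner_integral lborel ?u (B / h * (L2_norm_fun K)\<^sup>2)"
    unfolding norm using K h(1)
    by (intro has_bochner_integral_mult_right has_bochner_integral_rescaled[where \<phi> = "\<lambda>u. (K u)\<^sup>2"])
  then have u_int: "integrable lborel ?u"
    by (simp only: has_bochner_integral_iff)
  have le: "AE y in lborel. f y * (1 / h * K ((y - x) / h))\<^sup>2 \<le> ?u y"
    using f(2) h(2) unfolding window_in_def
  proof eventually_elim
    case (elim y)
    have "f y * (1 / h * K ((y - x) / h))\<^sup>2 \<le> B * (1 / h * K ((y - x) / h))\<^sup>2"
      using elim by (cases "K ((y - x) / h) = 0") (auto intro: mult_right_mono)
    then show ?case by (simp add: power2_eq_square)
  qed
  show ?int
  proof (rule Bochner_Integration.integrable_bound[OF u_int])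
    show "AE y in lborel. norm (f y * (1 / h * K ((y - x) / h))\<^sup>2) \<le> norm (?u y)"
      using le
    proof eventually_elim
      case (elim y)
      have "0 \<le> f y * (1 / h * K ((y - x) / h))\<^sup>2" using f(1) by simp
      then show ?case using elim unfolding real_norm_def by linarith
    qed
  qed measurable
  then show ?bd
    using integral_mono_AE[OF _ u_int le] u by (simp add: has_bochner_integral_iff)
qed

section \<open>Averages of independent random variables\<close>

context prob_space
begin

text \<open>
  The cross terms have mean zero, since a summand is independent of the sum of the others.
\<close>

lemma indep_vars_centred_sum_square:
  fixes Z :: "'i \<Rightarrow> 'a \<Rightarrow> real"
  assumes "finite I" "indep_vars (\<lambda>_. borel) Z I"
    and "\<And>i. i \<in> I \<Longrightarrow> integrable M (\<lambda>\<omega>. (Z i \<omega>)\<^sup>2)"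
    and "\<And>i. i \<in> I \<Longrightarrow> expectation (Z i) = 0"
  shows "has_bochner_integral M (\<lambda>\<omega>. (\<Sum>i\<in>I. Z i \<omega>)\<^sup>2) (\<Sum>i\<in>I. expectation (\<lambda>\<omega>. (Z i \<omega>)\<^sup>2))"
  using assms
proof (induction I rule: finite_induct)
  case empty
  then show ?case by (simp add: has_bochner_integral_zero)
next
  case (insert i I)
  let ?S = "\<lambda>\<omega>. \<Sum>j\<in>I. Z j \<omega>"
  have IH: "has_bochner_integral M (\<lambda>\<omega>. (?S \<omega>)\<^sup>2) (\<Sum>i\<in>I. expectation (\<lambda>\<omega>. (Z i \<omega>)\<^sup>2))"
    using insert.prems by (intro insert.IH) (auto intro: indep_vars_subset)
  have Z: "integrable M (Z j)" if "j \<in> insert i I" for j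
  proof (rule square_integrable_imp_integrable)
    show "Z j \<in> borel_measurable M"
      using insert.prems(1) that unfolding indep_vars_def by blast
  qed (rule insert.prems(2)[OF that])
  have S: "integrable M ?S" "expectation ?S = 0"
    using Z insert.prems(3) by (auto simp: Bochner_Integration.integral_sum)
  have indep: "indep_var borel (Z i) borel ?S"
    using insert by (intro indep_vars_sum) auto
  have ZS: "has_bochner_integral M (\<lambda>\<omega>. Z i \<omega> * ?S \<omega>) 0"
    using indep_var_integrable[OF indep] indep_var_lebesgue_integral[OF indep] Z S
    by (simp add: has_bochner_integral_iff)
  have "has_bochner_integral M (\<lambda>\<omega>. (Z i \<omega>)\<^sup>2 + (?S \<omega>)\<^sup>2 + 2 * (Z i \<omega> * ?S \<omega>))
      (expectation (\<lambda>\<omega>. (Z i \<omega>)\<^sup>2) + (\<Sum>i\<in>I. expectation (\<lambda>\<omega>. (Z i \<omega>)\<^sup>2)) + 2 * 0)"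
    using insert.prems(2)[of i] IH ZS
    by (intro has_bochner_integral_add has_bochner_integral_mult_right has_bochner_integral_integrable) auto
  moreover have "(\<Sum>j\<in>insert i I. Z j \<omega>)\<^sup>2 = (Z i \<omega>)\<^sup>2 + (?S \<omega>)\<^sup>2 + 2 * (Z i \<omega> * ?S \<omega>)" for \<omega>
    using insert.hyps by (simp add: power2_sum)
  ultimately show ?case
    using insert.hyps by simp
qed

text \<open>
  Bias-variance decomposition: after centring, the square of the average error splits into the
  squared mean of the biases and the variance of the average, and each variance is at most the
  corresponding second moment.
\<close>

lemma mean_square_error_average:
  fixes Y :: "'i \<Rightarrow> 'a \<Rightarrow> real"
  assumes I: "finite I" "I \<noteq> {}" and indep: "indep_vars (\<lambda>_. borel) Y I"
    and sq: "\<And>i. i \<in> I \<Longrightarrow> integrable M (\<lambda>\<omega>. (Y i \<omega>)\<^sup>2)"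
    and bias: "\<And>i. i \<in> I \<Longrightarrow> \<bar>expectation (Y i) - \<theta>\<bar> \<le> b i"
    and var: "\<And>i. i \<in> I \<Longrightarrow> expectation (\<lambda>\<omega>. (Y i \<omega>)\<^sup>2) \<le> v i"
  shows "integrable M (\<lambda>\<omega>. ((\<Sum>i\<in>I. Y i \<omega>) / real (card I) - \<theta>)\<^sup>2)" (is ?int)
    and "expectation (\<lambda>\<omega>. ((\<Sum>i\<in>I. Y i \<omega>) / real (card I) - \<theta>)\<^sup>2)
      \<le> ((\<Sum>i\<in>I. b i)\<^sup>2 + (\<Sum>i\<in>I. v i)) / (real (card I))\<^sup>2" (is ?bd)
proof -
  define N where "N = real (card I)"
  have N: "N > 0" using I by (simp add: N_def card_gt_0_iff)
  define Z where "Z i \<omega> = Y i \<omega> - expectation (Y i)" for i \<omega>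
  define \<Delta> where "\<Delta> = (\<Sum>i\<in>I. expectation (Y i) - \<theta>)"
  have Y: "integrable M (Y i)" if "i \<in> I" for i
  proof (rule square_integrable_imp_integrable)
    show "Y i \<in> borel_measurable M"
      using indep that unfolding indep_vars_def by blast
  qed (rule sq[OF that])
  have Z: "integrable M (Z i)" "expectation (Z i) = 0" if "i \<in> I" for i
    using Y[OF that] by (simp_all add: Z_def[abs_def] prob_space)
  have Z2: "integrable M (\<lambda>\<omega>. (Z i \<omega>)\<^sup>2)" if "i \<in> I" for i
    unfolding Z_def power2_diff using Y[OF that] sq[OF that] by auto
  have Zvar: "expectation (\<lambda>\<omega>. (Z i \<omega>)\<^sup>2) \<le> v i" if "i \<in> I" for i
    using variance_eq[OF Y[OF that] sq[OF that]] var[OF that]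
      zero_le_power2[of "expectation (Y i)"] unfolding Z_def by linarith
  have indepZ: "indep_vars (\<lambda>_. borel) Z I"
    unfolding Z_def by (rule indep_vars_compose2[OF indep]) measurable
  note S2 = indep_vars_centred_sum_square[OF I(1) indepZ Z2 Z(2)]
  let ?S = "\<lambda>\<omega>. \<Sum>i\<in>I. Z i \<omega>"
  have S: "has_bochner_integral M ?S 0"
    using Z by (simp add: has_bochner_integral_iff Bochner_Integration.integral_sum)
  have eq: "((\<Sum>i\<in>I. Y i \<omega>) / N - \<theta>)\<^sup>2 = ((?S \<omega>)\<^sup>2 + \<Delta>\<^sup>2 + 2 * \<Delta> * ?S \<omega>) / N\<^sup>2" for \<omega>
  proof -
    have "(\<Sum>i\<in>I. Y i \<omega>) / N - \<theta> = (?S \<omega> + \<Delta>) / N"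
      using N by (simp add: Z_def \<Delta>_def sum_subtractf N_def field_simps)
    then show ?thesis by (simp add: power_divide power2_sum algebra_simps)
  qed
  have "has_bochner_integral M (\<lambda>\<omega>. ((?S \<omega>)\<^sup>2 + \<Delta>\<^sup>2 + 2 * \<Delta> * ?S \<omega>) / N\<^sup>2)
      (((\<Sum>i\<in>I. expectation (\<lambda>\<omega>. (Z i \<omega>)\<^sup>2)) + \<Delta>\<^sup>2 + 2 * \<Delta> * 0) / N\<^sup>2)"
  proof (intro has_bochner_integral_divide_zero has_bochner_integral_add has_bochner_integral_mult_right S S2)
    show "has_bochner_integral M (\<lambda>\<omega>. \<Delta>\<^sup>2) (\<Delta>\<^sup>2)"
      by (simp add: has_bochner_integral_iff prob_space)
  qed
  then have *: "has_bochner_integral M (\<lambda>\<omega>. ((\<Sum>i\<in>I. Y i \<omega>) / N - \<theta>)\<^sup>2)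
      (((\<Sum>i\<in>I. expectation (\<lambda>\<omega>. (Z i \<omega>)\<^sup>2)) + \<Delta>\<^sup>2) / N\<^sup>2)"
    unfolding eq by simp
  then show ?int by (simp add: has_bochner_integral_iff N_def)
  have "\<bar>\<Delta>\<bar> \<le> (\<Sum>i\<in>I. b i)"
    unfolding \<Delta>_def using bias by (intro order_trans[OF sum_abs] sum_mono) auto
  then have "\<Delta>\<^sup>2 \<le> (\<Sum>i\<in>I. b i)\<^sup>2"
    by (metis abs_ge_zero power2_abs power_mono)
  moreover have "(\<Sum>i\<in>I. expectation (\<lambda>\<omega>. (Z i \<omega>)\<^sup>2)) \<le> (\<Sum>i\<in>I. v i)"
    by (intro sum_mono Zvar)
  ultimately have "((\<Sum>i\<in>I. expectation (\<lambda>\<omega>. (Z i \<omega>)\<^sup>2)) + \<Delta>\<^sup>2) / N\<^sup>2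
      \<le> ((\<Sum>i\<in>I. b i)\<^sup>2 + (\<Sum>i\<in>I. v i)) / N\<^sup>2"
    by (intro divide_right_mono) auto
  then show ?bd using * by (simp add: has_bochner_integral_iff N_def)
qed

end

section \<open>Risk of the Wolverton-Wagner estimator\<close>

theorem proposition2p3:
  fixes \<beta> L \<kappa> C :: real and T :: "real set"
  assumes "\<beta> > 0" and "L > 0" and "is_interval T"
  shows "\<exists>c > 0. \<forall>(K :: real \<Rightarrow> real) (f :: real \<Rightarrow> real) (n :: nat) (h :: nat \<Rightarrow> real)
      (M :: 'a measure) (X :: nat \<Rightarrow> 'a \<Rightarrow> real).
    kernel_of_order (nat \<lfloor>\<beta>\<rfloor>) K \<longrightarrow>
    integrable lborel (\<lambda>y. (K y)\<^sup>2) \<longrightarrow>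
    integrable lborel (\<lambda>z. \<bar>z\<bar> powr \<beta> * \<bar>K z\<bar>) \<longrightarrow>
    L2_norm_fun K = \<kappa> \<longrightarrow>
    abs_moment \<beta> K = C \<longrightarrow>
    (\<forall>y. f y \<ge> 0) \<longrightarrow>
    f \<in> holder_class \<beta> L T \<longrightarrow>
    n \<ge> 1 \<longrightarrow>
    h n > 0 \<longrightarrow>
    (\<forall>k \<in> {1..<n}. h (Suc k) < h k) \<longrightarrow>
    prob_space M \<longrightarrow>
    prob_space.indep_vars M (\<lambda>_. borel) X {1..n} \<longrightarrow>
    (\<forall>k \<in> {1..n}. distributed M lborel (X k) (\<lambda>y. ennreal (f y))) \<longrightarrow>
    (\<forall>x \<in> T. (\<forall>k \<in> {1..n}. window_in T K (h k) x) \<longrightarrow>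
       integrable M (\<lambda>\<omega>. \<bar>wolverton_wagner K n h (\<lambda>k. X k \<omega>) x - f x\<bar>\<^sup>2) \<and>
       (LINT \<omega>|M. \<bar>wolverton_wagner K n h (\<lambda>k. X k \<omega>) x - f x\<bar>\<^sup>2)
         \<le> c / (real n)\<^sup>2 *
            (\<bar>\<Sum>k=1..n. h k powr \<beta> / fact (nat \<lfloor>\<beta>\<rfloor>)\<bar>\<^sup>2 + (\<Sum>k=1..n. 1 / h k)))"
proof -
  define q :: real where "q = fact (nat \<lfloor>\<beta>\<rfloor>)"
  have q: "q > 0" by (simp add: q_def)
  obtain B where B: "B \<ge> 0"
    "\<And>f. f \<in> holder_class \<beta> L T \<Longrightarrow> (\<And>y. f y \<ge> 0) \<Longrightarrow> integrable lborel f
      \<Longrightarrow> (LINT y|lborel. f y) = 1 \<Longrightarrow> AE y in lborel. y \<in> T \<longrightarrow> f y \<le> B"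
    using density_bound_on_interval[of T \<beta> L] assms by auto
  \<comment> \<open>The factor \<open>q\<close> offsets the division by \<open>q\<close> in the bound, which the bias estimate does not provide;
    the summand 1 makes \<open>c\<close> positive.\<close>
  define c where "c = (L * C * q)\<^sup>2 + B * \<kappa>\<^sup>2 + 1"
  have c: "c > 0" "(L * C * q)\<^sup>2 \<le> c" "B * \<kappa>\<^sup>2 \<le> c"
    using B(1) by (simp_all add: c_def add_nonneg_pos)
  show ?thesis
    unfolding q_def[symmetric]
  proof (rule exI[of _ c], intro conjI allI impI ballI c(1))
    fix K f :: "real \<Rightarrow> real" and n :: nat and h :: "nat \<Rightarrow> real" and M :: "'a measure"
      and X :: "nat \<Rightarrow> 'a \<Rightarrow> real" and x :: real
    assume K: "kernel_of_order (nat \<lfloor>\<beta>\<rfloor>) K" "integrable lborel (\<lambda>y. (K y)\<^sup>2)"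
        "integrable lborel (\<lambda>z. \<bar>z\<bar> powr \<beta> * \<bar>K z\<bar>)" "L2_norm_fun K = \<kappa>" "abs_moment \<beta> K = C"
      and f: "\<forall>y. f y \<ge> 0" "f \<in> holder_class \<beta> L T"
      and n: "n \<ge> 1" and h: "h n > 0" "\<forall>k \<in> {1..<n}. h (Suc k) < h k"
      and "prob_space M"
      and indep: "prob_space.indep_vars M (\<lambda>_. borel) X {1..n}"
      and X: "\<forall>k \<in> {1..n}. distributed M lborel (X k) (\<lambda>y. ennreal (f y))"
      and x: "x \<in> T" and window: "\<forall>k \<in> {1..n}. window_in T K (h k) x"
    interpret prob_space M by fact
    have X1: "distributed M lborel (X 1) (\<lambda>y. ennreal (f y))" using X n by simp
    have f_meas: "f \<in> borel_measurable lborel"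
      using distributed_real_measurable[OF _ X1] f(1) by simp
    then have [measurable]: "f \<in> borel_measurable borel" by simp
    have [measurable]: "K \<in> borel_measurable borel"
      using K(1) by (simp add: kernel_of_order_def)
    have "integrable lborel f" "(LINT y|lborel. f y) = 1"
      using distributed_integrable[OF X1, of "\<lambda>_. 1"] distributed_integral[OF X1, of "\<lambda>_. 1"] f(1)
      by (simp_all add: prob_space)
    then have f_le: "AE y in lborel. y \<in> T \<longrightarrow> f y \<le> B"
      using B(2)[OF f(2)] f(1) by blast
    have h_pos: "h k > 0" if "k \<in> {1..n}" for k
    proof -
      have "k \<le> n" "1 \<le> k" using that by auto
      then show ?thesis
      proof (induction rule: inc_induct)
        case (step m)
        then have "h (Suc m) < h m" "0 < h (Suc m)" using h(2) by auto
        then show ?case by linarith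
      qed (use h in simp)
    qed
    let ?g = "\<lambda>k y. 1 / h k * K ((y - x) / h k)"
    let ?Y = "\<lambda>k \<omega>. ?g k (X k \<omega>)"
    have indepY: "indep_vars (\<lambda>_. borel) ?Y {1..n}"
      by (rule indep_vars_compose2[OF indep]) measurable
    have sq: "integrable M (\<lambda>\<omega>. (?Y k \<omega>)\<^sup>2)"
      and var: "expectation (\<lambda>\<omega>. (?Y k \<omega>)\<^sup>2) \<le> B * \<kappa>\<^sup>2 / h k"
      and bias: "\<bar>expectation (?Y k) - f x\<bar> \<le> L * C * h k powr \<beta>" if k: "k \<in> {1..n}" for k
    proof -
      have Xk: "distributed M lborel (X k) (\<lambda>y. ennreal (f y))" using X k by simp
      have g2: "(\<lambda>y. (?g k y)\<^sup>2) \<in> borel_measurable lborel" by measurable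
      have g: "?g k \<in> borel_measurable lborel" by measurable
      note mom = rescaled_kernel_second_moment[OF _ _ K(2) _ f_le h_pos[OF k], of x]
      have "integrable lborel (\<lambda>y. f y * (?g k y)\<^sup>2)"
        by (rule mom(1)) (use f window k in auto)
      then show "integrable M (\<lambda>\<omega>. (?Y k \<omega>)\<^sup>2)"
        using distributed_integrable[OF Xk g2] f(1) by simp
      have "(LINT y|lborel. f y * (?g k y)\<^sup>2) \<le> B * (L2_norm_fun K)\<^sup>2 / h k"
        by (rule mom(2)) (use f window k in auto)
      then show "expectation (\<lambda>\<omega>. (?Y k \<omega>)\<^sup>2) \<le> B * \<kappa>\<^sup>2 / h k"
        using distributed_integral[OF Xk g2] f(1) K(4) by simp
      have E: "(LINT y|lborel. f y * ?g k y) = expectation (?Y k)"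
        by (rule distributed_integral[OF Xk g]) (use f in simp)
      have "\<bar>(LINT y|lborel. f y * ?g k y) - f x\<bar> \<le> L * (h k powr \<beta> * abs_moment \<beta> K)"
        by (rule rescaled_kernel_bias[where T = T]) (use K f assms x window k h_pos in auto)
      then show "\<bar>expectation (?Y k) - f x\<bar> \<le> L * C * h k powr \<beta>"
        using E K(5) by (simp only: mult.assoc mult.commute mult.left_commute)
    qed
    have ww: "\<bar>wolverton_wagner K n h (\<lambda>k. X k \<omega>) x - f x\<bar>\<^sup>2
        = ((\<Sum>k\<in>{1..n}. ?Y k \<omega>) / real (card {1..n}) - f x)\<^sup>2" for \<omega>
      by (simp add: wolverton_wagner_def)
    note mse = mean_square_error_average[OF _ _ indepY sq bias var]
    show "integrable M (\<lambda>\<omega>. \<bar>wolverton_wagner K n h (\<lambda>k. X k \<omega>) x - f x\<bar>\<^sup>2)"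
      unfolding ww by (rule mse(1)) (use n in auto)
    have "(LINT \<omega>|M. \<bar>wolverton_wagner K n h (\<lambda>k. X k \<omega>) x - f x\<bar>\<^sup>2)
        \<le> ((\<Sum>k\<in>{1..n}. L * C * h k powr \<beta>)\<^sup>2 + (\<Sum>k\<in>{1..n}. B * \<kappa>\<^sup>2 / h k)) / (real (card {1..n}))\<^sup>2"
      unfolding ww by (rule mse(2)) (use n in auto)
    also have "(\<Sum>k\<in>{1..n}. L * C * h k powr \<beta>)\<^sup>2 = (L * C * q)\<^sup>2 * \<bar>\<Sum>k=1..n. h k powr \<beta> / q\<bar>\<^sup>2"
      using q by (simp add: sum_distrib_left[symmetric] sum_divide_distrib[symmetric] power_mult_distrib power_divide)
    also have "(\<Sum>k\<in>{1..n}. B * \<kappa>\<^sup>2 / h k) = B * \<kappa>\<^sup>2 * (\<Sum>k=1..n. 1 / h k)"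
      by (simp add: sum_distrib_left)
    also have "((L * C * q)\<^sup>2 * \<bar>\<Sum>k=1..n. h k powr \<beta> / q\<bar>\<^sup>2 + B * \<kappa>\<^sup>2 * (\<Sum>k=1..n. 1 / h k)) / (real (card {1..n}))\<^sup>2
        \<le> (c * \<bar>\<Sum>k=1..n. h k powr \<beta> / q\<bar>\<^sup>2 + c * (\<Sum>k=1..n. 1 / h k)) / (real (card {1..n}))\<^sup>2"
      using h_pos by (intro divide_right_mono add_mono mult_right_mono c) (auto intro!: sum_nonneg simp: less_imp_le)
    also have "\<dots> = c / (real n)\<^sup>2 * (\<bar>\<Sum>k=1..n. h k powr \<beta> / q\<bar>\<^sup>2 + (\<Sum>k=1..n. 1 / h k))"
      by (simp add: algebra_simps add_divide_distrib)
    finally show "(LINT \<omega>|M. \<bar>wolverton_wagner K n h (\<lambda>k. X k \<omega>) x - f x\<bar>\<^sup>2)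
        \<le> c / (real n)\<^sup>2 * (\<bar>\<Sum>k=1..n. h k powr \<beta> / q\<bar>\<^sup>2 + (\<Sum>k=1..n. 1 / h k))" .
  qed
qed

end
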